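(* Let $G$ be the $\mathbb{T}^2$-bundle over the circle $S^1=\mathbb{R}/\mathbb{Z}$ arising as the quotient of the trivial $\mathbb{T}^2$-bundle $\mathbb{T}^2\times\mathbb{R}\to\mathbb{R}$ modulo the equivalence $$(a,b;t)\sim(a,a^lb;t+l)\qquad(l\in\mathbb{Z}).$$ Then a given representation $\rho:\mathbb{T}^2\to\operatorname{U}(k)$ of a fiber of $G$ may be extended to an invertible pseudo-representation of $G$ only if its restriction to the subgroup $1\times\mathbb{T}^1\subset\mathbb{T}^2$ lies within $\operatorname{SU}(k)$.
   Context: $\mathbb{T}^n=\operatorname{U}(1)^n$, and representations are continuous homomorphisms. $G$ is regarded as a groupoid over $S^1$ whose source and target maps both equal the bundle projection $\pi:G\to S^1$; the fiber over the class of $t_0\in\mathbb{R}$ is identified with $\mathbb{T}^2$ via $(a,b)\mapsto[(a,b;t_0)]$. An invertible pseudo-representation of $G$ on a complex vector bundle $E$ over $S^1$ is an automorphism of vector bundles $\lambda:\pi^*E\to\pi^*E$ over $G$, i.e. a continuous family of linear isomorphisms $\lambda(g)\in\operatorname{GL}(E_{\pi(g)})$, $g\in G$ (not required to be multiplicative or unital). That $\lambda$ extends $\rho:\mathbb{T}^2\to\operatorname{U}(k)$ means that for some $t_0\in\mathbb{R}$, with $x_0=[t_0]$, there is a linear isomorphism $E_{x_0}\cong\mathbb{C}^k$ under which $\lambda([(a,b;t_0)])$ corresponds to $\rho(a,b)$ for all $(a,b)\in\mathbb{T}^2$. *)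

theory Defs
  imports
    "HOL-Analysis.Analysis"
    "Jordan_Normal_Form.VS_Connect"
    "Jordan_Normal_Form.Schur_Decomposition"
begin

section \<open>Topologies on vectors and matrices\<close>

text \<open>The types of vectors and matrices of variable dimension carry no topology in the library;
  we give \<open>\<complex>\<^sup>n\<close> and the \<open>n \<times> m\<close> matrices the usual (product) topology, pulled back along the entries.\<close>

definition vec_topology :: "nat \<Rightarrow> complex vec topology" where
  "vec_topology n =
     pullback_topology (carrier_vec n) (\<lambda>v. \<lambda>i\<in>{..<n}. vec_index v i)
       (product_topology (\<lambda>_. euclidean) {..<n})"

definition mat_topology :: "nat \<Rightarrow> nat \<Rightarrow> complex mat topology" where
  "mat_topology n m =
     pullback_topology (carrier_mat n m) (\<lambda>A. \<lambda>ij\<in>{..<n} \<times> {..<m}. index_mat A ij)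
       (product_topology (\<lambda>_. euclidean) ({..<n} \<times> {..<m}))"

section \<open>Unitary groups, tori and representations\<close>

definition U_group :: "nat \<Rightarrow> complex mat monoid" where
  "U_group k = \<lparr>carrier = {A \<in> carrier_mat k k. mat_adjoint A * A = 1\<^sub>m k \<and> A * mat_adjoint A = 1\<^sub>m k},
     mult = (*), one = 1\<^sub>m k\<rparr>"

definition SU :: "nat \<Rightarrow> complex mat set" where
  "SU k = {A \<in> carrier (U_group k). Determinant.det A = 1}"

text \<open>\<open>U(1)\<close> is realised as the unit complex numbers rather than as \<open>1 \<times> 1\<close> matrices.\<close>

definition U1 :: "complex monoid" where
  "U1 = \<lparr>carrier = {z. norm z = 1}, mult = (*), one = 1\<rparr>"

definition T2 :: "(complex \<times> complex) monoid" where
  "T2 = U1 \<times>\<times> U1"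

definition unitary_rep :: "nat \<Rightarrow> (complex \<times> complex \<Rightarrow> complex mat) \<Rightarrow> bool" where
  "unitary_rep k \<rho> \<longleftrightarrow>
     \<rho> \<in> hom T2 (U_group k) \<and>
     continuous_map (top_of_set (carrier T2)) (subtopology (mat_topology k k) (carrier (U_group k))) \<rho>"

section \<open>Quotient spaces\<close>

definition quotient_topology :: "'a topology \<Rightarrow> ('a \<times> 'a) set \<Rightarrow> 'a set topology" where
  "quotient_topology X r =
     topology (\<lambda>V. V \<subseteq> topspace X // r \<and> openin X {x \<in> topspace X. r `` {x} \<in> V})"

lemma openin_quotient_topology:
  "openin (quotient_topology X r) V \<longleftrightarrow>
     V \<subseteq> topspace X // r \<and> openin X {x \<in> topspace X. r `` {x} \<in> V}"
proof -
  let ?P = "\<lambda>V. V \<subseteq> topspace X // r \<and> openin X {x \<in> topspace X. r `` {x} \<in> V}"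
  have "istopology ?P"
    unfolding istopology_def
  proof (intro conjI allI impI)
    fix S T assume "?P S" "?P T"
    moreover have "{x \<in> topspace X. r `` {x} \<in> S \<inter> T} =
        {x \<in> topspace X. r `` {x} \<in> S} \<inter> {x \<in> topspace X. r `` {x} \<in> T}" by auto
    ultimately show "S \<inter> T \<subseteq> topspace X // r"
      and "openin X {x \<in> topspace X. r `` {x} \<in> S \<inter> T}" by auto
  next
    fix \<K> assume K: "\<forall>S\<in>\<K>. ?P S"
    show "\<Union>\<K> \<subseteq> topspace X // r" using K by blast
    have "{x \<in> topspace X. r `` {x} \<in> \<Union>\<K>} = \<Union>((\<lambda>S. {x \<in> topspace X. r `` {x} \<in> S}) ` \<K>)" by auto
    then show "openin X {x \<in> topspace X. r `` {x} \<in> \<Union>\<K>}"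
      using K by (metis (no_types, lifting) image_iff openin_Union)
  qed
  then show ?thesis by (simp add: quotient_topology_def topology_inverse')
qed

lemma topspace_quotient_topology [simp]: "topspace (quotient_topology X r) = topspace X // r"
proof -
  have "openin (quotient_topology X r) (topspace X // r)"
  proof -
    have "{x \<in> topspace X. r `` {x} \<in> topspace X // r} = topspace X"
      by (auto simp: quotient_def)
    then show ?thesis by (simp add: openin_quotient_topology)
  qed
  then show ?thesis
    by (meson openin_quotient_topology openin_subset openin_topspace subset_antisym)
qed

lemma quotient_map_quotient_topology:
  "quotient_map X (quotient_topology X r) (\<lambda>x. r `` {x})"
  by (auto simp: quotient_map_def openin_quotient_topology quotient_def)

section \<open>Complex vector bundles\<close>

record ('e, 'b) vbundle =
  total_space :: "'e topology"
  base_space :: "'b topology"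
  proj :: "'e \<Rightarrow> 'b"
  fibre :: "'b \<Rightarrow> (complex, 'e) module"

abbreviation complex_linear ::
    "(complex, 'v) module \<Rightarrow> (complex, 'w) module \<Rightarrow> ('v \<Rightarrow> 'w) \<Rightarrow> bool" where
  "complex_linear \<equiv> linear_map class_ring"

definition linear_iso ::
    "(complex, 'v) module \<Rightarrow> (complex, 'w) module \<Rightarrow> ('v \<Rightarrow> 'w) \<Rightarrow> bool" where
  "linear_iso V W f \<longleftrightarrow> complex_linear V W f \<and> bij_betw f (carrier V) (carrier W)"

text \<open>The rank \<open>n\<close> is only required to be locally constant.\<close>

definition local_trivialization ::
    "('e, 'b) vbundle \<Rightarrow> 'b set \<Rightarrow> nat \<Rightarrow> ('e \<Rightarrow> 'b \<times> complex vec) \<Rightarrow> bool" where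
  "local_trivialization E U n \<phi> \<longleftrightarrow>
     openin (base_space E) U \<and>
     homeomorphic_map (subtopology (total_space E) {e \<in> topspace (total_space E). proj E e \<in> U})
       (prod_topology (subtopology (base_space E) U) (vec_topology n)) \<phi> \<and>
     (\<forall>e \<in> topspace (total_space E). proj E e \<in> U \<longrightarrow> fst (\<phi> e) = proj E e) \<and>
     (\<forall>x \<in> U. complex_linear (fibre E x) (module_vec TYPE(complex) n) (snd \<circ> \<phi>))"

definition complex_vector_bundle :: "('e, 'b) vbundle \<Rightarrow> bool" where
  "complex_vector_bundle E \<longleftrightarrow>
     continuous_map (total_space E) (base_space E) (proj E) \<and>
     (\<forall>x \<in> topspace (base_space E).
        vectorspace class_ring (fibre E x) \<and>
        carrier (fibre E x) = {e \<in> topspace (total_space E). proj E e = x}) \<and>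
     (\<forall>x \<in> topspace (base_space E). \<exists>U n \<phi>. x \<in> U \<and> local_trivialization E U n \<phi>)"

definition pullback_bundle ::
    "'g topology \<Rightarrow> ('g \<Rightarrow> 'b) \<Rightarrow> ('e, 'b) vbundle \<Rightarrow> ('g \<times> 'e, 'g) vbundle" where
  "pullback_bundle X f E =
     \<lparr>total_space = subtopology (prod_topology X (total_space E)) {(g, e). f g = proj E e},
      base_space = X,
      proj = fst,
      fibre = (\<lambda>g. \<lparr>carrier = {g} \<times> carrier (fibre E (f g)),
                  mult = undefined, one = undefined,
                  zero = (g, \<zero>\<^bsub>fibre E (f g)\<^esub>),
                  add = (\<lambda>u v. (g, snd u \<oplus>\<^bsub>fibre E (f g)\<^esub> snd v)),
                  smult = (\<lambda>c u. (g, c \<odot>\<^bsub>fibre E (f g)\<^esub> snd u))\<rparr>)\<rparr>"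

definition bundle_automorphism :: "('e, 'b) vbundle \<Rightarrow> ('e \<Rightarrow> 'e) \<Rightarrow> bool" where
  "bundle_automorphism E \<Lambda> \<longleftrightarrow>
     continuous_map (total_space E) (total_space E) \<Lambda> \<and>
     (\<forall>e \<in> topspace (total_space E). proj E (\<Lambda> e) = proj E e) \<and>
     (\<forall>x \<in> topspace (base_space E). linear_iso (fibre E x) (fibre E x) \<Lambda>)"

section \<open>The torus bundle over the circle\<close>

definition int_shift :: "(real \<times> real) set" where
  "int_shift = {(t, t + of_int l) | t (l :: int). True}"

definition circle :: "real set topology" where
  "circle = quotient_topology euclideanreal int_shift"

definition circle_class :: "real \<Rightarrow> real set" where
  "circle_class t = int_shift `` {t}"

type_synonym cover_point = "(complex \<times> complex) \<times> real"

definition gluing :: "(cover_point \<times> cover_point) set" where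
  "gluing = {(((a, b), t), ((a, a powi l * b), t + of_int l)) | a b t (l :: int).
     (a, b) \<in> carrier T2}"

definition G :: "cover_point set topology" where
  "G = quotient_topology (prod_topology (top_of_set (carrier T2)) euclideanreal) gluing"

definition G_class :: "complex \<Rightarrow> complex \<Rightarrow> real \<Rightarrow> cover_point set" where
  "G_class a b t = gluing `` {((a, b), t)}"

text \<open>The bundle projection \<open>[(a, b; t)] \<mapsto> [t]\<close>: points are equivalence classes, and the
  \<open>t\<close>-coordinates of the members of such a class form a class modulo \<open>\<int>\<close>; see
  \<open>G_proj_class\<close> below.\<close>

definition G_proj :: "cover_point set \<Rightarrow> real set" where
  "G_proj g = snd ` g"

lemma carrier_T2: "(a, b) \<in> carrier T2 \<longleftrightarrow> norm a = 1 \<and> norm b = 1"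
  by (simp add: T2_def U1_def)

lemma equiv_int_shift: "equiv UNIV int_shift"
proof (rule equivI)
  show "refl int_shift"
    unfolding refl_on_def int_shift_def by (auto intro: exI[of _ "0::int"])
  show "sym int_shift"
  proof (rule symI)
    fix s t assume "(s, t) \<in> int_shift"
    then obtain l :: int where "t = s + of_int l" by (auto simp: int_shift_def)
    then have "s = t + of_int (- l)" by simp
    then show "(t, s) \<in> int_shift" unfolding int_shift_def by blast
  qed
  show "trans int_shift"
  proof (rule transI)
    fix r s t assume "(r, s) \<in> int_shift" "(s, t) \<in> int_shift"
    then obtain l m :: int where "s = r + of_int l" "t = s + of_int m" by (auto simp: int_shift_def)
    then have "t = r + of_int (l + m)" by simp
    then show "(r, t) \<in> int_shift" unfolding int_shift_def by blast
  qed
qed auto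

lemma equiv_gluing: "equiv (carrier T2 \<times> UNIV) gluing"
proof (rule equivI)
  show "refl_on (carrier T2 \<times> UNIV) gluing"
    unfolding refl_on_def gluing_def by (force intro: exI[of _ "0::int"])
  show "gluing \<subseteq> (carrier T2 \<times> UNIV) \<times> carrier T2 \<times> UNIV"
    unfolding gluing_def by (auto simp: carrier_T2 norm_mult norm_power_int)
  show "sym gluing"
  proof (rule symI)
    fix x y assume "(x, y) \<in> gluing"
    then obtain a b t and l :: int where
      x: "x = ((a, b), t)" and y: "y = ((a, a powi l * b), t + of_int l)"
      and ab: "(a, b) \<in> carrier T2"
      unfolding gluing_def by blast
    have a: "a \<noteq> 0" using ab by (auto simp: carrier_T2)
    have "x = ((a, a powi (- l) * (a powi l * b)), t + of_int l + of_int (- l))"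
      using a by (simp add: x power_int_minus)
    moreover have "(a, a powi l * b) \<in> carrier T2"
      using ab by (auto simp: carrier_T2 norm_mult norm_power_int)
    ultimately show "(y, x) \<in> gluing" unfolding gluing_def y by blast
  qed
  show "trans gluing"
  proof (rule transI)
    fix x y z assume "(x, y) \<in> gluing" "(y, z) \<in> gluing"
    then obtain a b t and l m :: int where
      x: "x = ((a, b), t)" and ab: "(a, b) \<in> carrier T2"
      and z: "z = ((a, a powi m * (a powi l * b)), t + of_int l + of_int m)"
      unfolding gluing_def by blast
    have a: "a \<noteq> 0" using ab by (auto simp: carrier_T2)
    have "z = ((a, a powi (l + m) * b), t + of_int (l + m))"
      using a by (simp add: z power_int_add)
    then show "(x, z) \<in> gluing" unfolding gluing_def x using ab by blast
  qed
qed

lemma G_proj_class: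
  assumes "(a, b) \<in> carrier T2"
  shows "G_proj (G_class a b t) = circle_class t"
  using assms unfolding G_proj_def G_class_def circle_class_def gluing_def int_shift_def
  by (force simp: image_iff)

section \<open>Invertible pseudo-representations\<close>

text \<open>As source and target of the groupoid \<open>G\<close> both equal the bundle projection,
  \<open>\<lambda>\<close> is a bundle automorphism of the pullback; it has the form \<open>(g, e) \<mapsto> (g, \<lambda>(g) e)\<close>.\<close>

definition invertible_pseudo_rep ::
    "('e, real set) vbundle \<Rightarrow> (cover_point set \<times> 'e \<Rightarrow> cover_point set \<times> 'e) \<Rightarrow> bool" where
  "invertible_pseudo_rep E \<Lambda> \<longleftrightarrow> bundle_automorphism (pullback_bundle G G_proj E) \<Lambda>"

definition extends_rep ::
    "('e, real set) vbundle \<Rightarrow> (cover_point set \<times> 'e \<Rightarrow> cover_point set \<times> 'e) \<Rightarrow>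
     nat \<Rightarrow> (complex \<times> complex \<Rightarrow> complex mat) \<Rightarrow> bool" where
  "extends_rep E \<Lambda> k \<rho> \<longleftrightarrow>
     (\<exists>t0 \<psi>. linear_iso (fibre E (circle_class t0)) (module_vec TYPE(complex) k) \<psi> \<and>
        (\<forall>(a, b) \<in> carrier T2. \<forall>e \<in> carrier (fibre E (circle_class t0)).
           \<psi> (snd (\<Lambda> (G_class a b t0, e))) = \<rho> (a, b) *\<^sub>v \<psi> e))"

end

theory Submission
  imports Defs
begin

text \<open>The fibrewise determinant of an invertible pseudo-representation is a continuous function
  \<open>d\<close> on \<open>G\<close> without zeros, and over \<open>t\<^sub>0\<close> it equals \<open>det \<rho>\<close>.  Moving along \<open>t \<mapsto> [(a, 1; t)]\<close> from \<open>t\<^sub>0\<close> to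
  \<open>t\<^sub>0 + 1\<close> leads from \<open>[(a, 1; t\<^sub>0)]\<close> to \<open>[(a, 1; t\<^sub>0 + 1)] = [(a, a\<^sup>-\<^sup>1; t\<^sub>0)]\<close>, so \<open>a \<mapsto> det \<rho>(a, 1)\<close> and
  \<open>a \<mapsto> det \<rho>(a, a\<^sup>-\<^sup>1)\<close> are homotopic as maps into \<open>\<complex> - {0}\<close>.  Their quotient \<open>a \<mapsto> det \<rho>(1, a\<^sup>-\<^sup>1)\<close>
  is thus a null-homotopic character of the circle; it has a continuous logarithm, which is
  additive up to a constant and bounded, so the character is trivial.\<close>

section \<open>Determinants of endomorphisms\<close>

lemma linear_map_comp:
  assumes "linear_map K V W f" "linear_map K W X g"
  shows "linear_map K V X (g \<circ> f)"
proof -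
  interpret f: linear_map K V W f by fact
  interpret g: linear_map K W X g by fact
  have "g \<circ> f \<in> module_hom K V X"
    by (auto simp: module_hom_def)
  then show ?thesis
    by unfold_locales
qed

lemma linear_iso_comp:
  assumes "linear_iso V W f" "linear_iso W X g"
  shows "linear_iso V X (g \<circ> f)"
  using assms by (auto simp: linear_iso_def intro: linear_map_comp bij_betw_trans)

lemma linear_iso_inv:
  assumes "linear_iso V W f"
  shows "linear_iso W V (inv_into (carrier V) f)"
proof -
  let ?g = "inv_into (carrier V) f"
  have bij: "bij_betw f (carrier V) (carrier W)" and "complex_linear V W f"
    using assms by (auto simp: linear_iso_def)
  interpret linear_map class_ring V W f by fact
  have img: "f ` carrier V = carrier W" and inj: "inj_on f (carrier V)"
    using bij by (auto simp: bij_betw_def)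
  have mem: "?g w \<in> carrier V" and fg: "f (?g w) = w" if "w \<in> carrier W" for w
    using that img by (auto intro: inv_into_into f_inv_into_f)
  have gf: "?g w = v" if "v \<in> carrier V" "f v = w" for v w
    using that inj by auto
  have "?g \<in> module_hom class_ring W V"
    unfolding module_hom_def
    by (auto simp: mem fg intro!: gf)
  then have "complex_linear W V ?g"
    by unfold_locales
  then show ?thesis
    using bij by (simp add: linear_iso_def bij_betw_inv_into)
qed

section \<open>Matrices of linear maps between coordinate spaces\<close>

definition mat_of_map :: "nat \<Rightarrow> nat \<Rightarrow> (complex vec \<Rightarrow> complex vec) \<Rightarrow> complex mat" where
  "mat_of_map m n T = Matrix.mat m n (\<lambda>(i, j). vec_index (T (unit_vec n j)) i)"

lemma mat_of_map_carrier [simp]: "mat_of_map m n T \<in> carrier_mat m n"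
  by (simp add: mat_of_map_def)

text \<open>Both sides agree on unit vectors. This spreads to all vectors by induction on a bound
  \<open>l\<close> from which on the entries of the vector vanish: each step splits off entry
  \<open>l\<close>, so that additivity and homogeneity suffice and no finite sums of vectors
  occur.\<close>

lemma mat_of_map_mult_vec:
  assumes "complex_linear (module_vec TYPE(complex) n) (module_vec TYPE(complex) m) T"
    and "v \<in> carrier_vec n"
  shows "T v = mat_of_map m n T *\<^sub>v v"
proof -
  interpret linear_map class_ring "module_vec TYPE(complex) n" "module_vec TYPE(complex) m" T
    by fact
  let ?A = "mat_of_map m n T"
  have T_carrier: "T u \<in> carrier_vec m" if "u \<in> carrier_vec n" for u
    using f_im that by (simp add: module_vec_simps)
  have T_plus: "T (u + w) = T u + T w" if "u \<in> carrier_vec n" "w \<in> carrier_vec n" for u w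
    using f_add that by (simp add: module_vec_simps)
  have T_scale: "T (c \<cdot>\<^sub>v u) = c \<cdot>\<^sub>v T u" if "u \<in> carrier_vec n" for c u
    using f_smult[of c u] that by (simp add: module_vec_simps)
  have T_unit: "T (unit_vec n j) = ?A *\<^sub>v unit_vec n j" if "j < n" for j
  proof
    show "dim_vec (T (unit_vec n j)) = dim_vec (?A *\<^sub>v unit_vec n j)"
      using T_carrier[of "unit_vec n j"] by (simp add: mat_of_map_def)
    fix i assume "i < dim_vec (?A *\<^sub>v unit_vec n j)"
    then show "vec_index (T (unit_vec n j)) i = vec_index (?A *\<^sub>v unit_vec n j) i"
      using that by (simp add: mat_of_map_def)
  qed
  have "T v = ?A *\<^sub>v v" if "l \<le> n" "v \<in> carrier_vec n" "\<And>i. l \<le> i \<Longrightarrow> i < n \<Longrightarrow> vec_index v i = 0" for l v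
    using that
  proof (induction l arbitrary: v)
    case 0
    \<comment> \<open>For \<open>l = 0\<close> the vector is zero; written as a multiple of itself
      by 0, it is handled by homogeneity alone.\<close>
    have v: "v = 0 \<cdot>\<^sub>v v" using 0 by auto
    have "T v = T (0 \<cdot>\<^sub>v v)" by (rule arg_cong[OF v])
    also have "\<dots> = 0 \<cdot>\<^sub>v T v" by (rule T_scale[OF 0(2)])
    also have "\<dots> = 0 \<cdot>\<^sub>v (?A *\<^sub>v v)"
      using T_carrier[OF 0(2)] by (intro eq_vecI) (auto simp: mat_of_map_def)
    also have "\<dots> = ?A *\<^sub>v (0 \<cdot>\<^sub>v v)"
      by (rule mult_mat_vec[OF mat_of_map_carrier 0(2), symmetric])
    also have "\<dots> = ?A *\<^sub>v v" by (rule arg_cong[OF v, symmetric])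
    finally show ?case .
  next
    case (Suc l)
    define w where "w = Matrix.vec n (\<lambda>i. if i = l then 0 else vec_index v i)"
    have w: "w \<in> carrier_vec n" by (simp add: w_def)
    have v: "v = w + vec_index v l \<cdot>\<^sub>v unit_vec n l"
      using Suc.prems by (intro eq_vecI) (auto simp: w_def)
    have "T w = ?A *\<^sub>v w"
      using Suc.prems by (intro Suc.IH) (auto simp: w_def)
    then have *: "T (w + vec_index v l \<cdot>\<^sub>v unit_vec n l) = ?A *\<^sub>v (w + vec_index v l \<cdot>\<^sub>v unit_vec n l)"
      using w Suc.prems(1)
      by (simp add: T_plus T_scale T_unit mult_add_distrib_mat_vec[OF mat_of_map_carrier]
          mult_mat_vec[OF mat_of_map_carrier])
    have "T v = T (w + vec_index v l \<cdot>\<^sub>v unit_vec n l)" by (rule arg_cong[OF v])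
    also note *
    also have "?A *\<^sub>v (w + vec_index v l \<cdot>\<^sub>v unit_vec n l) = ?A *\<^sub>v v"
      by (rule arg_cong[OF v, symmetric])
    finally show ?case .
  qed
  from this[of n v] assms(2) show ?thesis by simp
qed

lemma mat_of_map_eqI:
  assumes "A \<in> carrier_mat m n" and "\<And>v. v \<in> carrier_vec n \<Longrightarrow> T v = A *\<^sub>v v"
  shows "mat_of_map m n T = A"
  using assms by (intro eq_matI) (auto simp: mat_of_map_def)

lemma mat_of_map_cong:
  assumes "\<And>v. v \<in> carrier_vec n \<Longrightarrow> S v = T v"
  shows "mat_of_map m n S = mat_of_map m n T"
  using assms by (auto simp: mat_of_map_def)

lemma mat_of_map_comp:
  assumes T: "complex_linear (module_vec TYPE(complex) n) (module_vec TYPE(complex) m) T"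
    and S: "complex_linear (module_vec TYPE(complex) m) (module_vec TYPE(complex) p) S"
  shows "mat_of_map p n (S \<circ> T) = mat_of_map p m S * mat_of_map m n T"
proof (rule mat_of_map_eqI)
  show "mat_of_map p m S * mat_of_map m n T \<in> carrier_mat p n"
    by (rule mult_carrier_mat[OF mat_of_map_carrier mat_of_map_carrier])
  fix v :: "complex vec" assume v: "v \<in> carrier_vec n"
  show "(S \<circ> T) v = mat_of_map p m S * mat_of_map m n T *\<^sub>v v"
    using v mult_mat_vec_carrier[OF mat_of_map_carrier v, of m T]
    by (simp add: mat_of_map_mult_vec[OF T] mat_of_map_mult_vec[OF S]
        assoc_mult_mat_vec[OF mat_of_map_carrier mat_of_map_carrier])
qed

lemma mat_of_map_id:
  assumes "\<And>v. v \<in> carrier_vec n \<Longrightarrow> T v = v"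
  shows "mat_of_map n n T = 1\<^sub>m n"
  using assms by (intro mat_of_map_eqI) auto

text \<open>The matrix of the inverse map inverts the matrix of \<open>T\<close>. The dimensions
  \<open>m\<close> and \<open>n\<close> are not yet known to agree, so both products are
  recorded.\<close>

lemma mat_of_map_inverse:
  assumes "linear_iso (module_vec TYPE(complex) n) (module_vec TYPE(complex) m) T"
  obtains Q where "Q \<in> carrier_mat n m" "mat_of_map m n T * Q = 1\<^sub>m m" "Q * mat_of_map m n T = 1\<^sub>m n"
proof -
  define S where "S = inv_into (carrier_vec n) T"
  have S: "linear_iso (module_vec TYPE(complex) m) (module_vec TYPE(complex) n) S"
    using linear_iso_inv[OF assms] by (simp add: S_def module_vec_simps)
  have bij: "bij_betw T (carrier_vec n) (carrier_vec m)"
    using assms by (simp add: linear_iso_def module_vec_simps)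
  have T_lin: "complex_linear (module_vec TYPE(complex) n) (module_vec TYPE(complex) m) T"
    and S_lin: "complex_linear (module_vec TYPE(complex) m) (module_vec TYPE(complex) n) S"
    using assms S by (simp_all add: linear_iso_def)
  show ?thesis
  proof
    show "mat_of_map n m S \<in> carrier_mat n m" by simp
    have "mat_of_map m m (T \<circ> S) = 1\<^sub>m m"
      using bij by (intro mat_of_map_id) (simp add: S_def bij_betw_inv_into_right)
    then show "mat_of_map m n T * mat_of_map n m S = 1\<^sub>m m"
      using mat_of_map_comp[OF S_lin T_lin] by simp
    have "mat_of_map n n (S \<circ> T) = 1\<^sub>m n"
      using bij by (intro mat_of_map_id) (simp add: S_def bij_betw_inv_into_left)
    then show "mat_of_map n m S * mat_of_map m n T = 1\<^sub>m n"
      using mat_of_map_comp[OF T_lin S_lin] by simp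
  qed
qed

text \<open>The traces of \<open>P * Q\<close> and \<open>Q * P\<close> coincide, so
  \<open>m\<close> and \<open>n\<close> have the same image in the field; characteristic zero makes
  them equal.\<close>

lemma two_sided_inverse_imp_square:
  fixes P Q :: "'a :: field_char_0 mat"
  assumes P: "P \<in> carrier_mat m n" and Q: "Q \<in> carrier_mat n m"
    and PQ: "P * Q = 1\<^sub>m m" and QP: "Q * P = 1\<^sub>m n"
  shows "m = n"
proof -
  have "of_nat m = (\<Sum>i<m. (P * Q) $$ (i, i))" by (simp add: PQ)
  also have "\<dots> = (\<Sum>i<m. \<Sum>j<n. P $$ (i, j) * Q $$ (j, i))"
    using P Q by (simp add: scalar_prod_def atLeast0LessThan)
  also have "\<dots> = (\<Sum>j<n. \<Sum>i<m. Q $$ (j, i) * P $$ (i, j))"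
    by (subst sum.swap) (simp add: mult.commute)
  also have "\<dots> = (\<Sum>j<n. (Q * P) $$ (j, j))"
    using P Q by (simp add: scalar_prod_def atLeast0LessThan)
  also have "\<dots> = (of_nat n :: 'a)" by (simp add: QP)
  finally show ?thesis by simp
qed

section \<open>The determinant of an endomorphism of an abstract space, by choice of
  coordinates\<close>

definition frame_mat ::
    "nat \<Rightarrow> (complex, 'v) module \<Rightarrow> ('v \<Rightarrow> complex vec) \<Rightarrow> ('v \<Rightarrow> 'v) \<Rightarrow> complex mat" where
  "frame_mat n V \<psi> L = mat_of_map n n (\<psi> \<circ> L \<circ> inv_into (carrier V) \<psi>)"

text \<open>Junk value if \<open>V\<close> is not finite-dimensional.\<close>

definition endo_det :: "(complex, 'v) module \<Rightarrow> ('v \<Rightarrow> 'v) \<Rightarrow> complex" where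
  "endo_det V L = (SOME d. \<exists>n \<psi>. linear_iso V (module_vec TYPE(complex) n) \<psi> \<and>
     d = Determinant.det (frame_mat n V \<psi> L))"

lemma frame_endo_linear:
  assumes \<psi>: "linear_iso V (module_vec TYPE(complex) n) \<psi>" and L: "complex_linear V V L"
  shows "complex_linear (module_vec TYPE(complex) n) (module_vec TYPE(complex) n)
    (\<psi> \<circ> L \<circ> inv_into (carrier V) \<psi>)"
proof -
  have p: "complex_linear V (module_vec TYPE(complex) n) \<psi>"
    and i: "complex_linear (module_vec TYPE(complex) n) V (inv_into (carrier V) \<psi>)"
    using \<psi> linear_iso_inv[OF \<psi>] by (simp_all add: linear_iso_def)
  show ?thesis
    unfolding comp_assoc by (rule linear_map_comp[OF linear_map_comp[OF i L] p])
qed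

text \<open>Change of basis: the transition matrix \<open>?P\<close> is invertible, hence square,
  and intertwines the two coordinate matrices, \<open>?B * ?P = ?P * ?A\<close>. Taking determinants
  and cancelling that of \<open>?P\<close> gives the claim. The dimensions are allowed to differ at
  first because \<open>endo_det\<close> chooses the dimension together with the coordinates.\<close>

lemma frame_mat_det_indep:
  assumes \<psi>: "linear_iso V (module_vec TYPE(complex) n) \<psi>"
    and \<psi>': "linear_iso V (module_vec TYPE(complex) m) \<psi>'"
    and L: "complex_linear V V L"
  shows "Determinant.det (frame_mat n V \<psi> L) = Determinant.det (frame_mat m V \<psi>' L)"
proof -
  let ?i = "inv_into (carrier V) \<psi>" and ?i' = "inv_into (carrier V) \<psi>'"
  let ?P = "mat_of_map m n (\<psi>' \<circ> ?i)"
  note i = linear_iso_inv[OF \<psi>] and i' = linear_iso_inv[OF \<psi>']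
  have T: "linear_iso (module_vec TYPE(complex) n) (module_vec TYPE(complex) m) (\<psi>' \<circ> ?i)"
    by (rule linear_iso_comp[OF i \<psi>'])
  obtain Q where Q: "Q \<in> carrier_mat n m" "?P * Q = 1\<^sub>m m" "Q * ?P = 1\<^sub>m n"
    by (rule mat_of_map_inverse[OF T])
  have P: "?P \<in> carrier_mat m n" by simp
  have mn: "m = n" by (rule two_sided_inverse_imp_square[OF P Q])
  let ?A = "frame_mat n V \<psi> L" and ?B = "frame_mat m V \<psi>' L"
  have lin: "complex_linear (module_vec TYPE(complex) n) (module_vec TYPE(complex) n) (\<psi> \<circ> L \<circ> ?i)"
    "complex_linear (module_vec TYPE(complex) m) (module_vec TYPE(complex) m) (\<psi>' \<circ> L \<circ> ?i')"
    using frame_endo_linear \<psi> \<psi>' L by blast+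
  have Lin: "L v \<in> carrier V" if "v \<in> carrier V" for v
    by (rule linear_map.T_im[OF L that])
  have iin: "?i v \<in> carrier V" if "v \<in> carrier_vec n" for v
    using \<psi> that inv_into_into[of v \<psi> "carrier V"]
    by (simp add: linear_iso_def bij_betw_def module_vec_simps)
  have "?B * ?P = mat_of_map m n ((\<psi>' \<circ> L \<circ> ?i') \<circ> (\<psi>' \<circ> ?i))"
    unfolding frame_mat_def using lin(2) T
    by (intro mat_of_map_comp[symmetric]) (simp_all add: linear_iso_def)
  \<comment> \<open>Coordinates cancel against their inverses only on \<open>carrier V\<close>, so
    the two composites are compared on \<open>carrier_vec n\<close> rather than as
    functions.\<close>
  also have "\<dots> = mat_of_map m n ((\<psi>' \<circ> ?i) \<circ> (\<psi> \<circ> L \<circ> ?i))"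
  proof (rule mat_of_map_cong)
    fix v :: "complex vec" assume "v \<in> carrier_vec n"
    then have v: "?i v \<in> carrier V" by (rule iin)
    have "?i' (\<psi>' (?i v)) = ?i v" "?i (\<psi> (L (?i v))) = L (?i v)"
      using \<psi> \<psi>' v Lin[OF v] by (simp_all add: linear_iso_def bij_betw_def)
    then show "(\<psi>' \<circ> L \<circ> ?i' \<circ> (\<psi>' \<circ> ?i)) v = (\<psi>' \<circ> ?i \<circ> (\<psi> \<circ> L \<circ> ?i)) v"
      by simp
  qed
  also have "\<dots> = ?P * ?A"
    unfolding frame_mat_def using lin(1) T
    by (intro mat_of_map_comp) (simp_all add: linear_iso_def)
  finally have BP: "?B * ?P = ?P * ?A" .
  have A: "?A \<in> carrier_mat n n" and B: "?B \<in> carrier_mat m m"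
    by (simp_all add: frame_mat_def)
  have "Determinant.det ?B * Determinant.det ?P = Determinant.det (?B * ?P)"
    by (rule det_mult[symmetric, OF B]) (simp add: mn)
  also have "\<dots> = Determinant.det ?P * Determinant.det ?A"
    unfolding BP by (rule det_mult) (use A in \<open>simp_all add: mn\<close>)
  finally have eq: "Determinant.det ?B * Determinant.det ?P = Determinant.det ?P * Determinant.det ?A" .
  have "Determinant.det ?P * Determinant.det Q = Determinant.det (?P * Q)"
    by (rule det_mult[symmetric]) (use Q(1) in \<open>simp_all add: mn\<close>)
  then have "Determinant.det ?P \<noteq> 0" using Q(2) by auto
  with eq show ?thesis by simp
qed

text \<open>Independence of the coordinates makes the choice in \<open>endo_det\<close>
  harmless.\<close>

lemma endo_det_eq:
  assumes "linear_iso V (module_vec TYPE(complex) n) \<psi>" and "complex_linear V V L"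
  shows "endo_det V L = Determinant.det (frame_mat n V \<psi> L)"
  unfolding endo_det_def
proof (rule some_equality)
  show "\<exists>m \<psi>'. linear_iso V (module_vec TYPE(complex) m) \<psi>' \<and>
      Determinant.det (frame_mat n V \<psi> L) = Determinant.det (frame_mat m V \<psi>' L)"
    using assms(1) by blast
  fix d assume "\<exists>m \<psi>'. linear_iso V (module_vec TYPE(complex) m) \<psi>' \<and>
      d = Determinant.det (frame_mat m V \<psi>' L)"
  then show "d = Determinant.det (frame_mat n V \<psi> L)"
    using frame_mat_det_indep[OF assms(1) _ assms(2)] by metis
qed

lemma endo_det_nonzero:
  assumes \<psi>: "linear_iso V (module_vec TYPE(complex) n) \<psi>" and L: "linear_iso V V L"
  shows "endo_det V L \<noteq> 0"
proof -
  let ?T = "\<psi> \<circ> L \<circ> inv_into (carrier V) \<psi>"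
  have "linear_iso (module_vec TYPE(complex) n) (module_vec TYPE(complex) n) ?T"
    using linear_iso_comp[OF linear_iso_inv[OF \<psi>] linear_iso_comp[OF L \<psi>]] by (simp add: comp_assoc)
  then obtain Q where Q: "Q \<in> carrier_mat n n" "mat_of_map n n ?T * Q = 1\<^sub>m n"
    by (rule mat_of_map_inverse)
  have "Determinant.det (mat_of_map n n ?T) * Determinant.det Q = Determinant.det (mat_of_map n n ?T * Q)"
    by (rule det_mult[symmetric, OF mat_of_map_carrier Q(1)])
  then have "Determinant.det (mat_of_map n n ?T) \<noteq> 0"
    unfolding Q(2) by auto
  then show ?thesis
    using endo_det_eq[OF \<psi>, of L] L by (simp add: frame_mat_def linear_iso_def)
qed

text \<open>Meant for the fibre over \<open>t0\<close>, where the extension hypothesis provides such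
  a relation with \<open>A = \<rho> (a, b)\<close>.\<close>

lemma endo_det_eqI:
  assumes \<psi>: "linear_iso V (module_vec TYPE(complex) n) \<psi>" and L: "complex_linear V V L"
    and A: "A \<in> carrier_mat n n"
    and eq: "\<And>e. e \<in> carrier V \<Longrightarrow> \<psi> (L e) = A *\<^sub>v \<psi> e"
  shows "endo_det V L = Determinant.det A"
proof -
  have bij: "bij_betw \<psi> (carrier V) (carrier_vec n)"
    using \<psi> by (simp add: linear_iso_def module_vec_simps)
  have "frame_mat n V \<psi> L = A"
    unfolding frame_mat_def
  proof (rule mat_of_map_eqI[OF A])
    fix v :: "complex vec" assume v: "v \<in> carrier_vec n"
    then have "inv_into (carrier V) \<psi> v \<in> carrier V" "\<psi> (inv_into (carrier V) \<psi> v) = v"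
      using bij bij_betw_inv_into_right[OF bij] bij_betw_apply[OF bij_betw_inv_into[OF bij]]
      by simp_all
    then show "(\<psi> \<circ> L \<circ> inv_into (carrier V) \<psi>) v = A *\<^sub>v v" by (simp add: eq)
  qed
  then show ?thesis using endo_det_eq[OF \<psi> L] by simp
qed

section \<open>Null-homotopic characters of the circle\<close>

text \<open>Powers of \<open>z\<close> stay on the circle, while additivity gives
  \<open>h (z ^ n) = of_nat n * h z\<close>, which is unbounded unless
  \<open>h z = 0\<close>.\<close>

lemma additive_bounded_circle_zero:
  fixes h :: "complex \<Rightarrow> complex"
  assumes bd: "\<And>z. norm z = 1 \<Longrightarrow> norm (h z) \<le> B"
    and add: "\<And>z w. norm z = 1 \<Longrightarrow> norm w = 1 \<Longrightarrow> h (z * w) = h z + h w"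
    and z: "norm z = 1"
  shows "h z = 0"
proof (rule ccontr)
  assume nz: "h z \<noteq> 0"
  have "h 1 = 0" using add[of 1 1] by simp
  then have pow: "h (z ^ n) = of_nat n * h z" for n
    using z by (induction n) (simp_all add: add norm_power algebra_simps)
  obtain n :: nat where "B < of_nat n * norm (h z)"
    using nz reals_Archimedean3[of "norm (h z)"] by auto
  moreover have "of_nat n * norm (h z) \<le> B"
    using bd[of "z ^ n"] z by (simp add: pow norm_mult norm_power)
  ultimately show False by simp
qed

text \<open>The kernel of \<open>exp\<close> consists of the integer multiples of
  \<open>2 * pi * \<i>\<close>. The gap around 0 makes continuous functions with values in this
  kernel locally constant.\<close>

lemma exp_eq_1_norm_ge:
  fixes w :: complex
  assumes "exp w = 1" "w \<noteq> 0"
  shows "2 * pi \<le> norm w"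
proof -
  obtain n :: int where n: "Re w = 0" "Im w = of_int (2 * n) * pi"
    using assms(1) by (auto simp: exp_eq_1)
  have "n \<noteq> 0" using n assms(2) by (auto simp: complex_eq_iff)
  then have "1 \<le> \<bar>real_of_int n\<bar>" by linarith
  then have "2 * pi \<le> \<bar>Im w\<bar>" using n by (simp add: abs_mult)
  then show ?thesis using abs_Im_le_cmod[of w] by linarith
qed

text \<open>The failure \<open>k\<close> of the logarithm \<open>g\<close> to be additive takes
  values in the kernel of \<open>exp\<close> and is continuous on a connected torus, hence constant.
  Shifting \<open>g\<close> by a constant makes it additive; being bounded on the compact circle, it
  then vanishes.\<close>

lemma character_with_logarithm_trivial:
  fixes f g :: "complex \<Rightarrow> complex"
  assumes mult: "\<And>z w. norm z = 1 \<Longrightarrow> norm w = 1 \<Longrightarrow> f (z * w) = f z * f w"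
    and g: "continuous_on (sphere 0 1) g" and f: "\<And>z. norm z = 1 \<Longrightarrow> f z = exp (g z)"
    and z: "norm z = 1"
  shows "f z = 1"
proof -
  let ?S = "sphere (0::complex) 1"
  define k where "k = (\<lambda>p. g (fst p * snd p) - g (fst p) - g (snd p))"
  have exp_k: "exp (k p) = 1" if "p \<in> ?S \<times> ?S" for p
    using that mult[of "fst p" "snd p"] by (auto simp: k_def exp_diff norm_mult simp flip: f)
  have cont_k: "continuous_on (?S \<times> ?S) k"
    unfolding k_def by (intro continuous_intros continuous_on_compose2[OF g]) (auto simp: norm_mult)
  have "k constant_on ?S \<times> ?S"
  proof (rule continuous_discrete_range_constant[OF _ cont_k])
    show "connected (?S \<times> ?S)"
      by (intro connected_Times connected_sphere) simp_all
    fix p assume p: "p \<in> ?S \<times> ?S"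
    have "2 * pi \<le> norm (k q - k p)" if "q \<in> ?S \<times> ?S" "k q \<noteq> k p" for q
      using that p by (intro exp_eq_1_norm_ge) (auto simp: exp_diff exp_k)
    then show "\<exists>e>0. \<forall>q. q \<in> ?S \<times> ?S \<and> k q \<noteq> k p \<longrightarrow> e \<le> norm (k q - k p)"
      by (intro exI[of _ "2 * pi"]) auto
  qed
  then obtain c where c: "\<And>p. p \<in> ?S \<times> ?S \<Longrightarrow> k p = c" by (auto simp: constant_on_def)
  \<comment> \<open>At \<open>(1, 1)\<close> the defect is \<open>g 1 - g 1 - g 1\<close>, so
    subtracting \<open>g 1\<close> from \<open>g\<close> is the shift that absorbs it.\<close>
  then have c1: "c = - g 1" using c[of "(1, 1)"] by (simp add: k_def)
  define h where "h = (\<lambda>z. g z - g 1)"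
  have add: "h (z * w) = h z + h w" if "norm z = 1" "norm w = 1" for z w
    using c[of "(z, w)"] that by (simp add: h_def k_def c1 algebra_simps)
  have "compact (h ` ?S)"
    unfolding h_def by (intro compact_continuous_image continuous_intros g) simp
  then obtain B where bound: "\<And>z. z \<in> ?S \<Longrightarrow> norm (h z) \<le> B"
    using compact_imp_bounded[of "h ` ?S"] unfolding bounded_iff by blast
  have "h z = 0"
    by (rule additive_bounded_circle_zero[of h B, OF _ add z]) (simp_all add: bound)
  then have "f z = f 1" using z by (simp add: h_def f)
  moreover have "f 1 = 1" using mult[of 1 1] by (simp add: f)
  ultimately show ?thesis by simp
qed

text \<open>Dividing \<open>F (z, s + \<tau>)\<close> by its initial value \<open>F (z, s)\<close>,
  for \<open>\<tau>\<close> from 0 to 1, gives a homotopy in the punctured plane from the constant 1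
  to \<open>f\<close>.\<close>

lemma nullhomotopic_character_trivial:
  fixes f :: "complex \<Rightarrow> complex" and F :: "complex \<times> real \<Rightarrow> complex"
  assumes mult: "\<And>z w. norm z = 1 \<Longrightarrow> norm w = 1 \<Longrightarrow> f (z * w) = f z * f w"
    and F: "continuous_on (sphere 0 1 \<times> UNIV) F" and F_nz: "\<And>z t. norm z = 1 \<Longrightarrow> F (z, t) \<noteq> 0"
    and ends: "\<And>z. norm z = 1 \<Longrightarrow> F (z, s + 1) = f z * F (z, s)"
    and z: "norm z = 1"
  shows "f z = 1"
proof -
  let ?S = "sphere (0::complex) 1"
  let ?H = "\<lambda>p. F (snd p, s + fst p) / F (snd p, s)"
  have "homotopic_with_canon (\<lambda>h. True) ?S (-{0}) (\<lambda>_. 1) f"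
  proof (subst homotopic_with, simp, intro exI[of _ ?H] conjI)
    have "continuous_on ({0..1} \<times> ?S) ?H"
      by (intro continuous_intros continuous_on_compose2[OF F]) (auto simp: F_nz)
    then show "continuous_map (prod_topology (top_of_set {0..1}) (top_of_set ?S)) (top_of_set (- {0})) ?H"
      by (auto simp: F_nz continuous_map_in_subtopology)
  qed (auto simp: F_nz ends)
  \<comment> \<open>On the circle, a map into the punctured plane is homotopic to a constant exactly
    if it has a continuous logarithm.\<close>
  then have "\<exists>a. homotopic_with_canon (\<lambda>h. True) ?S (-{0}) f (\<lambda>_. a)"
    using homotopic_with_sym by blast
  then obtain g where "continuous_on ?S g" "\<And>x. x \<in> ?S \<Longrightarrow> f x = exp (g x)"
    using inessential_eq_continuous_logarithm[of ?S f] by blast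
  then show ?thesis
    using character_with_logarithm_trivial[of f g z] mult z by simp
qed

section \<open>Determinants of bundle automorphisms\<close>

lemma continuous_map_vec_index:
  assumes "i < n"
  shows "continuous_map (vec_topology n) euclidean (\<lambda>v. vec_index v i)"
proof -
  have "continuous_map (vec_topology n) euclidean ((\<lambda>x. x i) \<circ> (\<lambda>v. \<lambda>i\<in>{..<n}. vec_index v i))"
    unfolding vec_topology_def
    using assms by (intro continuous_map_pullback continuous_map_product_projection) simp
  then show ?thesis using assms by (simp add: comp_def)
qed

lemma topspace_vec_topology [simp]: "topspace (vec_topology n) = carrier_vec n"
  by (auto simp: vec_topology_def topspace_pullback_topology)

text \<open>The Leibniz formula \<open>?F\<close> is a polynomial in the entries.\<close>

lemma continuous_map_det:
  fixes A :: "'a \<Rightarrow> complex mat"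
  assumes A: "\<And>x. x \<in> topspace X \<Longrightarrow> A x \<in> carrier_mat n n"
    and cont: "\<And>i j. i < n \<Longrightarrow> j < n \<Longrightarrow> continuous_map X euclidean (\<lambda>x. A x $$ (i, j))"
  shows "continuous_map X euclidean (\<lambda>x. Determinant.det (A x))"
proof -
  let ?F = "\<lambda>a :: nat \<times> nat \<Rightarrow> complex.
    \<Sum>p | p permutes {0..<n}. signof p * (\<Prod>i = 0..<n. a (i, p i))"
  \<comment> \<open>Padding the entries with 0 turns a matrix into a function on all of
    \<open>nat \<times> nat\<close>, where the Euclidean topology is the product topology and
    \<open>?F\<close> is continuous everywhere.\<close>
  let ?e = "\<lambda>x ij. if ij \<in> {..<n} \<times> {..<n} then A x $$ ij else 0"
  have "continuous_on UNIV ?F"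
    by (intro continuous_intros continuous_on_product_coordinates)
  moreover have "continuous_map X euclidean ?e"
  proof -
    have "continuous_map X euclidean (\<lambda>x. ?e x ij)" for ij
      using cont by (cases ij; cases "ij \<in> {..<n} \<times> {..<n}") auto
    then have "continuous_map X (product_topology (\<lambda>_. euclidean) UNIV) ?e"
      by (simp add: continuous_map_componentwise_UNIV)
    then show ?thesis by (simp add: euclidean_product_topology)
  qed
  ultimately have "continuous_map X euclidean (?F \<circ> ?e)"
    by (intro continuous_map_compose) (auto)
  moreover have "(?F \<circ> ?e) x = Determinant.det (A x)" if "x \<in> topspace X" for x
    unfolding det_def'[OF A[OF that]] comp_def
    by (intro sum.cong refl arg_cong2[where f = "(*)"] prod.cong)
      (auto dest: permutes_in_image)
  ultimately show ?thesis by (rule continuous_map_eq)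
qed

section \<open>Local frames and the fibrewise action of an automorphism\<close>

text \<open>The definition asks only for linearity on fibres; the inverse homeomorphism
  \<open>\<sigma>\<close>, restricted to one fibre, supplies bijectivity. The sections
  \<open>\<sigma> (x, unit_vec n j)\<close> will serve as a continuous local frame.\<close>

lemma local_trivialization_inverse:
  assumes E: "complex_vector_bundle E" and triv: "local_trivialization E U n \<phi>"
  obtains \<sigma> where
    "continuous_map (prod_topology (subtopology (base_space E) U) (vec_topology n)) (total_space E) \<sigma>"
    "\<forall>x\<in>U. \<forall>v\<in>carrier_vec n. \<sigma> (x, v) \<in> carrier (fibre E x) \<and> \<phi> (\<sigma> (x, v)) = (x, v)"
    "\<forall>x\<in>U. linear_iso (fibre E x) (module_vec TYPE(complex) n) (snd \<circ> \<phi>)"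
proof -
  let ?T = "subtopology (total_space E) {e \<in> topspace (total_space E). proj E e \<in> U}"
  let ?P = "prod_topology (subtopology (base_space E) U) (vec_topology n)"
  have U: "U \<subseteq> topspace (base_space E)" and hom: "homeomorphic_map ?T ?P \<phi>"
    and fst: "\<And>e. e \<in> topspace (total_space E) \<Longrightarrow> proj E e \<in> U \<Longrightarrow> fst (\<phi> e) = proj E e"
    and lin: "\<And>x. x \<in> U \<Longrightarrow> complex_linear (fibre E x) (module_vec TYPE(complex) n) (snd \<circ> \<phi>)"
    using triv by (auto simp: local_trivialization_def openin_subset)
  have carrier: "carrier (fibre E x) = {e \<in> topspace (total_space E). proj E e = x}" if "x \<in> U" for x
    using E U that by (auto simp: complex_vector_bundle_def)
  obtain \<sigma> where \<sigma>: "homeomorphic_maps ?T ?P \<phi> \<sigma>"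
    using hom by (auto simp: homeomorphic_map_maps)
  have topP: "topspace ?P = U \<times> carrier_vec n" using U by auto
  have cont: "continuous_map ?P ?T \<sigma>"
    and \<sigma>\<phi>: "\<And>e. e \<in> topspace ?T \<Longrightarrow> \<sigma> (\<phi> e) = e" and \<phi>\<sigma>: "\<And>y. y \<in> topspace ?P \<Longrightarrow> \<phi> (\<sigma> y) = y"
    using \<sigma> by (auto simp: homeomorphic_maps_def)
  have \<sigma>_in: "\<sigma> (x, v) \<in> topspace ?T" if "x \<in> U" "v \<in> carrier_vec n" for x v
    using continuous_map_image_subset_topspace[OF cont] that unfolding topP by blast
  have mem: "\<sigma> (x, v) \<in> carrier (fibre E x)" if "x \<in> U" "v \<in> carrier_vec n" for x v
    using \<sigma>_in[OF that] fst[of "\<sigma> (x, v)"] \<phi>\<sigma>[of "(x, v)"] that U by (auto simp: carrier)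
  have inv: "\<phi> (\<sigma> (x, v)) = (x, v)" if "x \<in> U" "v \<in> carrier_vec n" for x v
    using \<phi>\<sigma> that topP by blast
  have inv': "\<sigma> (x, snd (\<phi> e)) = e" if "x \<in> U" "e \<in> carrier (fibre E x)" for x e
  proof -
    have "e \<in> topspace ?T" "fst (\<phi> e) = x" using that by (auto simp: carrier fst)
    then show ?thesis using \<sigma>\<phi> by (metis prod.collapse)
  qed
  have "linear_iso (fibre E x) (module_vec TYPE(complex) n) (snd \<circ> \<phi>)" if x: "x \<in> U" for x
  proof -
    have "snd (\<phi> e) \<in> carrier_vec n" if "e \<in> carrier (fibre E x)" for e
      using linear_map.T_im[OF lin[OF x] that] by (simp add: module_vec_simps)
    then have "bij_betw (snd \<circ> \<phi>) (carrier (fibre E x)) (carrier_vec n)"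
      using x by (intro bij_betw_byWitness[where f' = "\<lambda>v. \<sigma> (x, v)"]) (auto simp: mem inv inv')
    then show ?thesis using lin[OF x] by (simp add: linear_iso_def module_vec_simps)
  qed
  moreover have "continuous_map ?P (total_space E) \<sigma>"
    using cont continuous_map_in_subtopology by blast
  ultimately show ?thesis using mem inv that by blast
qed

text \<open>The fibre of the pullback at \<open>g\<close> is a copy of the fibre of \<open>E\<close>
  at \<open>p g\<close>, labelled by \<open>g\<close>, with operations on second components;
  dropping the label transfers the isomorphism.\<close>

lemma pullback_automorphism_fibre:
  assumes E: "complex_vector_bundle E" and p: "continuous_map Y (base_space E) p"
    and \<Lambda>: "bundle_automorphism (pullback_bundle Y p E) \<Lambda>" and g: "g \<in> topspace Y"
  shows "linear_iso (fibre E (p g)) (fibre E (p g)) (\<lambda>e. snd (\<Lambda> (g, e)))"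
proof -
  let ?V = "fibre E (p g)" and ?W = "fibre (pullback_bundle Y p E) g"
  have "p g \<in> topspace (base_space E)"
    using continuous_map_image_subset_topspace[OF p] g by blast
  then have V: "vectorspace class_ring ?V"
    using E by (auto simp: complex_vector_bundle_def)
  have iso: "linear_iso ?W ?W \<Lambda>"
    using \<Lambda> g by (simp add: bundle_automorphism_def pullback_bundle_def)
  then interpret W: linear_map class_ring ?W ?W \<Lambda> by (simp add: linear_iso_def)
  interpret V: vectorspace class_ring ?V by fact
  have bij: "bij_betw \<Lambda> ({g} \<times> carrier ?V) ({g} \<times> carrier ?V)"
    using iso by (simp add: linear_iso_def pullback_bundle_def)
  have im: "snd (\<Lambda> (g, e)) \<in> carrier ?V" if "e \<in> carrier ?V" for e
    using W.f_im[of "(g, e)"] that by (auto simp: pullback_bundle_def)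
  have add: "snd (\<Lambda> (g, u \<oplus>\<^bsub>?V\<^esub> v)) = snd (\<Lambda> (g, u)) \<oplus>\<^bsub>?V\<^esub> snd (\<Lambda> (g, v))"
    if "u \<in> carrier ?V" "v \<in> carrier ?V" for u v
    using W.f_add[of "(g, u)" "(g, v)"] that by (simp add: pullback_bundle_def)
  have smult: "snd (\<Lambda> (g, c \<odot>\<^bsub>?V\<^esub> v)) = c \<odot>\<^bsub>?V\<^esub> snd (\<Lambda> (g, v))" if "v \<in> carrier ?V" for c v
    using W.f_smult[of c "(g, v)"] that by (simp add: pullback_bundle_def)
  have "(\<lambda>e. snd (\<Lambda> (g, e))) \<in> module_hom class_ring ?V ?V"
    by (auto simp: module_hom_def im add smult)
  then have "complex_linear ?V ?V (\<lambda>e. snd (\<Lambda> (g, e)))"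
    by unfold_locales
  moreover have "bij_betw (\<lambda>e. snd (\<Lambda> (g, e))) (carrier ?V) (carrier ?V)"
  proof -
    have "bij_betw (\<lambda>e. (g, e)) (carrier ?V) ({g} \<times> carrier ?V)"
      "bij_betw snd ({g} \<times> carrier ?V) (carrier ?V)"
      by (auto simp: bij_betw_def inj_on_def)
    from bij_betw_trans[OF bij_betw_trans[OF this(1) bij] this(2)] show ?thesis
      by (simp add: comp_def)
  qed
  ultimately show ?thesis by (simp add: linear_iso_def)
qed

text \<open>Local triviality provides the finite coordinates through which \<open>endo_det\<close>
  is computed.\<close>

lemma pullback_automorphism_det_nonzero:
  assumes E: "complex_vector_bundle E" and p: "continuous_map Y (base_space E) p"
    and \<Lambda>: "bundle_automorphism (pullback_bundle Y p E) \<Lambda>" and g: "g \<in> topspace Y"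
  shows "endo_det (fibre E (p g)) (\<lambda>e. snd (\<Lambda> (g, e))) \<noteq> 0"
proof -
  have "p g \<in> topspace (base_space E)"
    using continuous_map_image_subset_topspace[OF p] g by blast
  then obtain U n \<phi> where "p g \<in> U" and triv: "local_trivialization E U n \<phi>"
    using E unfolding complex_vector_bundle_def by blast
  then have "linear_iso (fibre E (p g)) (module_vec TYPE(complex) n) (snd \<circ> \<phi>)"
    using local_trivialization_inverse[OF E triv] by metis
  then show ?thesis
    by (rule endo_det_nonzero[OF _ pullback_automorphism_fibre[OF E p \<Lambda> g]])
qed

text \<open>Continuity is local on \<open>Y\<close>. Over the preimage \<open>W\<close> of a
  trivializing set, \<open>?d\<close> is the determinant of the matrix of the automorphism in a
  continuous frame, so it is enough that each entry is continuous.\<close>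

lemma pullback_automorphism_det_continuous:
  assumes E: "complex_vector_bundle E" and p: "continuous_map Y (base_space E) p"
    and \<Lambda>: "bundle_automorphism (pullback_bundle Y p E) \<Lambda>"
  shows "continuous_map Y euclidean (\<lambda>g. endo_det (fibre E (p g)) (\<lambda>e. snd (\<Lambda> (g, e))))"
    (is "continuous_map Y euclidean ?d")
proof -
  let ?PE = "total_space (pullback_bundle Y p E)"
  have local: "\<exists>W. openin Y W \<and> g0 \<in> W \<and> continuous_map (subtopology Y W) euclidean ?d"
    if g0: "g0 \<in> topspace Y" for g0
  proof -
    have "p g0 \<in> topspace (base_space E)"
      using continuous_map_image_subset_topspace[OF p] g0 by blast
    then obtain U n \<phi> where g0U: "p g0 \<in> U" and triv: "local_trivialization E U n \<phi>"
      using E unfolding complex_vector_bundle_def by blast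
    obtain \<sigma> where \<sigma>:
      "continuous_map (prod_topology (subtopology (base_space E) U) (vec_topology n)) (total_space E) \<sigma>"
      and \<sigma>_inv: "\<forall>x\<in>U. \<forall>v\<in>carrier_vec n. \<sigma> (x, v) \<in> carrier (fibre E x) \<and> \<phi> (\<sigma> (x, v)) = (x, v)"
      and iso: "\<forall>x\<in>U. linear_iso (fibre E x) (module_vec TYPE(complex) n) (snd \<circ> \<phi>)"
      by (rule local_trivialization_inverse[OF E triv])
    define W where "W = {g \<in> topspace Y. p g \<in> U}"
    let ?Y = "subtopology Y W"
    have U: "openin (base_space E) U" using triv by (simp add: local_trivialization_def)
    have W: "openin Y W" unfolding W_def by (rule openin_continuous_map_preimage[OF p U])
    have topW: "topspace ?Y = W" by (auto simp: W_def)
    have carrier: "carrier (fibre E x) = {e \<in> topspace (total_space E). proj E e = x}" if "x \<in> U" for x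
      using E openin_subset[OF U] that by (auto simp: complex_vector_bundle_def)
    have pW: "continuous_map ?Y (subtopology (base_space E) U) p"
      using continuous_map_from_subtopology[OF p, of W]
      by (auto simp: continuous_map_in_subtopology W_def)
    let ?A = "\<lambda>g. frame_mat n (fibre E (p g)) (snd \<circ> \<phi>) (\<lambda>e. snd (\<Lambda> (g, e)))"
    have "continuous_map ?Y euclidean (\<lambda>g. Determinant.det (?A g))"
    proof (rule continuous_map_det)
      fix i j assume i: "i < n" and j: "j < n"
      \<comment> \<open>\<open>s\<close> is the \<open>j\<close>-th frame section pulled back to
        \<open>W\<close> and \<open>L\<close> its image under the automorphism; entry
        \<open>(i, j)\<close> is the \<open>i\<close>-th coordinate of \<open>L\<close>.\<close>
      define s where "s = (\<lambda>g. \<sigma> (p g, unit_vec n j))"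
      define L where "L = (\<lambda>g. snd (\<Lambda> (g, s g)))"
      have s_mem: "s g \<in> carrier (fibre E (p g))" if "g \<in> W" for g
        using that \<sigma>_inv by (simp add: s_def W_def)
      have "continuous_map ?Y (prod_topology (subtopology (base_space E) U) (vec_topology n))
          (\<lambda>g. (p g, unit_vec n j))"
        by (intro continuous_map_pairedI pW) simp
      then have s: "continuous_map ?Y (total_space E) s"
        using continuous_map_compose[OF _ \<sigma>] by (auto simp: s_def comp_def)
      have "continuous_map ?Y (prod_topology Y (total_space E)) (\<lambda>g. (g, s g))"
        by (intro continuous_map_pairedI s continuous_map_from_subtopology) simp
      then have "continuous_map ?Y ?PE (\<lambda>g. (g, s g))"
        using s_mem carrier
        by (auto simp: pullback_bundle_def continuous_map_in_subtopology W_def)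
      then have "continuous_map ?Y ?PE (\<Lambda> \<circ> (\<lambda>g. (g, s g)))"
        by (rule continuous_map_compose) (use \<Lambda> in \<open>simp add: bundle_automorphism_def\<close>)
      then have "continuous_map ?Y (total_space E) (snd \<circ> (\<Lambda> \<circ> (\<lambda>g. (g, s g))))"
        by (rule continuous_map_compose)
          (simp add: pullback_bundle_def continuous_map_from_subtopology continuous_map_snd)
      then have L: "continuous_map ?Y (total_space E) L"
        by (simp add: L_def comp_def)
      have L_mem: "L g \<in> carrier (fibre E (p g))" if "g \<in> W" for g
        using pullback_automorphism_fibre[OF E p \<Lambda>, of g] s_mem[OF that] that
        by (auto simp: L_def W_def linear_iso_def bij_betw_def)
      have "continuous_map ?Y (subtopology (total_space E) {e \<in> topspace (total_space E). proj E e \<in> U}) L"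
        using L L_mem carrier by (auto simp: continuous_map_in_subtopology W_def)
      moreover have "continuous_map (subtopology (total_space E) {e \<in> topspace (total_space E). proj E e \<in> U})
          (prod_topology (subtopology (base_space E) U) (vec_topology n)) \<phi>"
        using triv by (simp add: local_trivialization_def homeomorphic_imp_continuous_map)
      ultimately have "continuous_map ?Y (prod_topology (subtopology (base_space E) U) (vec_topology n)) (\<phi> \<circ> L)"
        by (rule continuous_map_compose)
      then have "continuous_map ?Y (vec_topology n) (snd \<circ> (\<phi> \<circ> L))"
        by (rule continuous_map_compose[OF _ continuous_map_snd])
      then have "continuous_map ?Y euclidean ((\<lambda>v. vec_index v i) \<circ> (snd \<circ> (\<phi> \<circ> L)))"
        by (rule continuous_map_compose[OF _ continuous_map_vec_index[OF i]])
      moreover have "((\<lambda>v. vec_index v i) \<circ> (snd \<circ> (\<phi> \<circ> L))) g = ?A g $$ (i, j)"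
        if "g \<in> topspace ?Y" for g
      proof -
        have g: "p g \<in> U" "g \<in> W" using that by (auto simp: W_def)
        have "(snd \<circ> \<phi>) (s g) = unit_vec n j" using \<sigma>_inv g by (simp add: s_def)
        moreover have "inj_on (snd \<circ> \<phi>) (carrier (fibre E (p g)))"
          using iso g(1) by (simp add: linear_iso_def bij_betw_def)
        ultimately have "inv_into (carrier (fibre E (p g))) (snd \<circ> \<phi>) (unit_vec n j) = s g"
          using s_mem[OF g(2)] by (metis inv_into_f_f)
        then show ?thesis using i j by (simp add: frame_mat_def mat_of_map_def L_def)
      qed
      ultimately show "continuous_map ?Y euclidean (\<lambda>g. ?A g $$ (i, j))"
        by (rule continuous_map_eq)
    qed (simp add: frame_mat_def)
    moreover have "Determinant.det (?A g) = ?d g" if "g \<in> topspace ?Y" for g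
    proof -
      have "g \<in> topspace Y" "p g \<in> U" using that by (auto simp: W_def)
      then show ?thesis
        using endo_det_eq[of "fibre E (p g)" n "snd \<circ> \<phi>" "\<lambda>e. snd (\<Lambda> (g, e))"] iso
          pullback_automorphism_fibre[OF E p \<Lambda>, of g] by (simp add: linear_iso_def)
    qed
    ultimately have "continuous_map ?Y euclidean ?d" by (rule continuous_map_eq)
    then show ?thesis using W g0 g0U by (auto simp: W_def)
  qed
  \<comment> \<open>The open sets on which \<open>?d\<close> is continuous, indexed by themselves,
    cover \<open>Y\<close>.\<close>
  let ?I = "{W. openin Y W \<and> continuous_map (subtopology Y W) euclidean ?d}"
  show ?thesis
  proof (rule pasting_lemma[where I = ?I and T = "\<lambda>W. W" and f = "\<lambda>_. ?d"])
    fix g assume "g \<in> topspace Y"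
    from local[OF this] show "\<exists>W. W \<in> ?I \<and> g \<in> W \<and> ?d g = ?d g" by blast
  qed auto
qed

section \<open>The torus bundle\<close>

lemma topspace_G: "topspace G = (carrier T2 \<times> UNIV) // gluing"
  by (simp add: G_def)

lemma G_class_in_G: "norm a = 1 \<Longrightarrow> norm b = 1 \<Longrightarrow> G_class a b t \<in> topspace G"
  by (simp add: topspace_G G_class_def quotientI carrier_T2)

text \<open>The gluing relation with \<open>l = 1\<close>. For \<open>b = inverse a\<close> it
  identifies \<open>G_class a 1 (t + 1)\<close> with \<open>G_class a (inverse a) t\<close>, which
  is how the twist of the bundle enters.\<close>

lemma G_class_shift:
  assumes "norm a = 1" "norm b = 1"
  shows "G_class a (a * b) (t + 1) = G_class a b t"
proof -
  have "(((a, b), t), ((a, a powi 1 * b), t + of_int 1)) \<in> gluing"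
    unfolding gluing_def using assms carrier_T2 by blast
  then show ?thesis
    unfolding G_class_def using equiv_class_eq[OF equiv_gluing] by (metis of_int_1 power_int_1_right)
qed

lemma circle_class_shift: "circle_class (t + 1) = circle_class t"
proof -
  have "(t, t + of_int 1) \<in> int_shift" unfolding int_shift_def by blast
  then show ?thesis
    unfolding circle_class_def using equiv_class_eq[OF equiv_int_shift] by (metis of_int_1)
qed

text \<open>By the universal property of the quotient, continuity is checked on the cover, where the
  projection becomes \<open>circle_class \<circ> snd\<close>.\<close>

lemma continuous_map_G_proj: "continuous_map G circle G_proj"
proof -
  let ?X = "prod_topology (top_of_set (carrier T2)) euclideanreal"
  have "continuous_map euclideanreal circle circle_class"
    unfolding circle_def circle_class_def
    by (rule quotient_imp_continuous_map[OF quotient_map_quotient_topology])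
  then have "continuous_map ?X circle (circle_class \<circ> snd)"
    by (rule continuous_map_compose[OF continuous_map_snd])
  moreover have "(circle_class \<circ> snd) x = (G_proj \<circ> (\<lambda>x. gluing `` {x})) x" if "x \<in> topspace ?X" for x
    using that G_proj_class[of "fst (fst x)" "snd (fst x)" "snd x"] by (cases x) (auto simp: G_class_def)
  ultimately have "continuous_map ?X circle (G_proj \<circ> (\<lambda>x. gluing `` {x}))"
    by (rule continuous_map_eq)
  then show ?thesis
    unfolding G_def
    using continuous_compose_quotient_map[OF quotient_map_quotient_topology] by blast
qed

text \<open>The map lifts to the cover as \<open>(a, t) \<mapsto> ((a, 1), t)\<close>, followed by
  the quotient map.\<close>

lemma continuous_map_G_class:
  "continuous_map (top_of_set (sphere 0 1 \<times> UNIV)) G (\<lambda>(a, t). G_class a 1 t)"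
proof -
  let ?X = "prod_topology (top_of_set (carrier T2)) euclideanreal"
  have X: "?X = top_of_set (carrier T2 \<times> UNIV)"
    using prod_topology_subtopology_eu[of "carrier T2" "UNIV :: real set"] by simp
  have "continuous_map (top_of_set (sphere 0 1 \<times> UNIV)) ?X (\<lambda>x. ((fst x, 1), snd x))"
    unfolding X by (auto simp: continuous_map_in_subtopology carrier_T2 intro!: continuous_intros)
  moreover have "continuous_map ?X G (\<lambda>x. gluing `` {x})"
    unfolding G_def by (rule quotient_imp_continuous_map[OF quotient_map_quotient_topology])
  ultimately have "continuous_map (top_of_set (sphere 0 1 \<times> UNIV)) G
      ((\<lambda>x. gluing `` {x}) \<circ> (\<lambda>x. ((fst x, 1), snd x)))"
    by (rule continuous_map_compose)
  then show ?thesis by (simp add: comp_def G_class_def case_prod_unfold)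
qed

theorem mainTheorem6:
  fixes k :: nat
    and \<rho> :: "complex \<times> complex \<Rightarrow> complex mat"
    and E :: "('e, real set) vbundle"
    and \<Lambda> :: "cover_point set \<times> 'e \<Rightarrow> cover_point set \<times> 'e"
  assumes "unitary_rep k \<rho>"
    and "complex_vector_bundle E" and "base_space E = circle"
    and "invertible_pseudo_rep E \<Lambda>"
    and "extends_rep E \<Lambda> k \<rho>"
  shows "\<rho> ` ({1} \<times> carrier U1) \<subseteq> SU k"
proof -
  have E: "complex_vector_bundle E" and p: "continuous_map G (base_space E) G_proj"
    and \<Lambda>: "bundle_automorphism (pullback_bundle G G_proj E) \<Lambda>"
    using assms continuous_map_G_proj by (simp_all add: invertible_pseudo_rep_def)
  \<comment> \<open>As a function on \<open>G\<close> itself, \<open>d\<close> has the same value at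
    all representatives of a class; this is what links the parameters \<open>t0\<close> and
    \<open>t0 + 1\<close>.\<close>
  define d where "d = (\<lambda>g. endo_det (fibre E (G_proj g)) (\<lambda>e. snd (\<Lambda> (g, e))))"
  have \<rho>_mem: "\<rho> (a, b) \<in> carrier (U_group k)" if "norm a = 1" "norm b = 1" for a b
    using assms(1) that by (auto simp: unitary_rep_def hom_def carrier_T2 Pi_iff)
  then have \<rho>_carrier: "\<rho> (a, b) \<in> carrier_mat k k" if "norm a = 1" "norm b = 1" for a b
    using that by (auto simp: U_group_def)
  have "\<rho> (x \<otimes>\<^bsub>T2\<^esub> y) = \<rho> x * \<rho> y" if "x \<in> carrier T2" "y \<in> carrier T2" for x y
    using assms(1) that by (auto simp: unitary_rep_def hom_def U_group_def)
  then have \<rho>_mult: "\<rho> (a * a', b * b') = \<rho> (a, b) * \<rho> (a', b')"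
    if "norm a = 1" "norm b = 1" "norm a' = 1" "norm b' = 1" for a b a' b'
    using that by (metis carrier_T2 T2_def U1_def mult_DirProd monoid.simps(1))
  have det_\<rho>_mult: "Determinant.det (\<rho> (a * a', b * b')) = Determinant.det (\<rho> (a, b)) * Determinant.det (\<rho> (a', b'))"
    if "norm a = 1" "norm b = 1" "norm a' = 1" "norm b' = 1" for a b a' b'
    using that by (simp add: \<rho>_mult det_mult[OF \<rho>_carrier \<rho>_carrier])
  obtain t0 \<psi> where \<psi>: "linear_iso (fibre E (circle_class t0)) (module_vec TYPE(complex) k) \<psi>"
    and ext: "\<And>a b e. (a, b) \<in> carrier T2 \<Longrightarrow> e \<in> carrier (fibre E (circle_class t0)) \<Longrightarrow>
      \<psi> (snd (\<Lambda> (G_class a b t0, e))) = \<rho> (a, b) *\<^sub>v \<psi> e"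
    using assms(5) unfolding extends_rep_def by blast
  \<comment> \<open>The coordinates \<open>\<psi>\<close> turn the action on the fibre over
    \<open>t0\<close> into multiplication by \<open>\<rho> (a, b)\<close>.\<close>
  have d_t0: "d (G_class a b t0) = Determinant.det (\<rho> (a, b))" if "norm a = 1" "norm b = 1" for a b
  proof -
    have G: "G_proj (G_class a b t0) = circle_class t0"
      using that by (simp add: G_proj_class carrier_T2)
    show ?thesis
      unfolding d_def G
      by (rule endo_det_eqI[OF \<psi> _ \<rho>_carrier[OF that] ext])
        (use pullback_automorphism_fibre[OF E p \<Lambda> G_class_in_G[OF that, of t0]] that in
          \<open>simp_all add: G linear_iso_def carrier_T2\<close>)
  qed
  define F where "F = (\<lambda>(a, t). d (G_class a 1 t))"
  have "continuous_map (top_of_set (sphere 0 1 \<times> UNIV)) euclidean (d \<circ> (\<lambda>(a, t). G_class a 1 t))"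
    unfolding d_def
    by (rule continuous_map_compose[OF continuous_map_G_class pullback_automorphism_det_continuous[OF E p \<Lambda>]])
  then have F: "continuous_on (sphere 0 1 \<times> UNIV) F"
    by (simp add: F_def comp_def case_prod_unfold)
  have F_nz: "F (a, t) \<noteq> 0" if "norm a = 1" for a t
    using pullback_automorphism_det_nonzero[OF E p \<Lambda>] G_class_in_G that by (simp add: F_def d_def)
  \<comment> \<open>This is the factor by which \<open>F (a, _)\<close> changes from
    \<open>t0\<close> to \<open>t0 + 1\<close>: the shift leads to \<open>(a, inverse a)\<close>,
    which is \<open>(1, inverse a)\<close> times \<open>(a, 1)\<close>.\<close>
  define \<eta> where "\<eta> = (\<lambda>a. Determinant.det (\<rho> (1, inverse a)))"
  have \<eta>: "\<eta> a = 1" if "norm a = 1" for a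
  proof (rule nullhomotopic_character_trivial[OF _ F F_nz _ that, where s = t0])
    fix z w :: complex assume "norm z = 1" "norm w = 1"
    then show "\<eta> (z * w) = \<eta> z * \<eta> w"
      using det_\<rho>_mult[of 1 "inverse z" 1 "inverse w"] by (simp add: \<eta>_def norm_inverse)
  next
    fix z :: complex assume z: "norm z = 1"
    then have "z \<noteq> 0" by auto
    \<comment> \<open>The second coordinate 1 is read as \<open>z * inverse z\<close>, so that the
      shift applies.\<close>
    then have "F (z, t0 + 1) = Determinant.det (\<rho> (z, inverse z))"
      using G_class_shift[of z "inverse z" t0] d_t0[of z "inverse z"] z by (simp add: F_def norm_inverse)
    also have "\<dots> = \<eta> z * F (z, t0)"
      using det_\<rho>_mult[of 1 "inverse z" z 1] d_t0[of z 1] z by (simp add: \<eta>_def F_def norm_inverse)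
    finally show "F (z, t0 + 1) = \<eta> z * F (z, t0)" .
  qed
  show ?thesis
  proof
    fix A assume "A \<in> \<rho> ` ({1} \<times> carrier U1)"
    then obtain b where b: "norm b = 1" "A = \<rho> (1, b)" by (auto simp: U1_def)
    \<comment> \<open>Inversion is a bijection of the circle, so \<open>\<eta>\<close> at
      \<open>inverse b\<close> yields the determinant of \<open>\<rho> (1, b)\<close> for every
      \<open>b\<close>.\<close>
    then have "Determinant.det A = 1"
      using \<eta>[of "inverse b"] by (simp add: \<eta>_def norm_inverse)
    then show "A \<in> SU k" using \<rho>_mem[of 1 b] b by (simp add: SU_def)
  qed
qed

end
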